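(* Let $\theta\in(0,1)$ and $m\in\mathbb{N}_+$ with $\theta^2=1/m$, and let $\overline{\gamma_\theta}$ be the probability measure on $[0,\theta]^2$ given by $\overline{\gamma_\theta}(B)=\frac{1}{\log(1+\theta^2)}\iint_B\frac{dx\,dy}{(1+xy)^2}$. Define on $[0,\theta]^2$ the extended digits $\overline{a}_n(x,y)=a_n(x)$ for $n\ge1$, $\overline{a}_0(x,y)=a_1(y)$, and $\overline{a}_{-n}(x,y)=a_{n+1}(y)$ for $n\ge1$. Then for every $x\in[0,\theta]$, $$\overline{\gamma_\theta}\big([0,x]\times[0,\theta]\ \big|\ \overline{a}_0,\overline{a}_{-1},\ldots\big)=\frac{(a\theta+1)\,x}{(ax+1)\,\theta}\qquad \overline{\gamma_\theta}\text{-a.s.},$$ where $a:=[\overline{a}_0\theta,\overline{a}_{-1}\theta,\ldots]$ is the number in $[0,\theta]$ whose $\theta$-expansion has digits $\overline{a}_0,\overline{a}_{-1},\ldots$, and the left side is the conditional probability given the $\sigma$-algebra generated by $\overline{a}_0,\overline{a}_{-1},\ldots$.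
   Context: $T_\theta(x)=\frac1x-\theta\left\lfloor\frac{1}{x\theta}\right\rfloor$ for $x\in(0,\theta]$, $T_\theta(0)=0$; $a_1(x)=\lfloor 1/(x\theta)\rfloor$ ($x\neq0$), $a_n(x)=a_1(T_\theta^{n-1}(x))$; digits lie in $\{m,m+1,\ldots\}$. The notation $[b_1\theta,b_2\theta,\ldots]$ denotes the continued fraction $\cfrac{1}{b_1\theta+\cfrac{1}{b_2\theta+\cdots}}$. *)

theory Defs
  imports "HOL-Probability.Probability"
begin

(* The maps below are only of interest on [0,theta]; outside it their values are irrelevant. *)

definition theta_map :: "real \<Rightarrow> real \<Rightarrow> real" where
  "theta_map \<theta> x = (if x = 0 then 0 else 1 / x - \<theta> * real_of_int \<lfloor>1 / (x * \<theta>)\<rfloor>)"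

(* The digit of 0 is left undefined in the usual definition; here it comes out as 0 (since
   1 / 0 = 0 in HOL).  This is not a genuine digit (those are positive), so it marks the end of a
   terminating expansion. *)
definition digit1 :: "real \<Rightarrow> real \<Rightarrow> int" where
  "digit1 \<theta> x = \<lfloor>1 / (x * \<theta>)\<rfloor>"

(* digit n is a_n, for n \<ge> 1 *)
definition digit :: "real \<Rightarrow> nat \<Rightarrow> real \<Rightarrow> int" where
  "digit \<theta> n x = digit1 \<theta> ((theta_map \<theta> ^^ (n - 1)) x)"

definition ext_digit :: "real \<Rightarrow> int \<Rightarrow> real \<times> real \<Rightarrow> int" where
  "ext_digit \<theta> n p =
     (if n \<ge> 1 then digit \<theta> (nat n) (fst p)
      else if n = 0 then digit1 \<theta> (snd p)
      else digit \<theta> (nat (- n) + 1) (snd p))"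

(* Convergents: cfrac_conv n c = 1 / (c 0 + 1 / (c 1 + ... + 1 / c (n - 1))) *)
primrec cfrac_conv :: "nat \<Rightarrow> (nat \<Rightarrow> real) \<Rightarrow> real" where
  "cfrac_conv 0 c = 0"
| "cfrac_conv (Suc n) c = 1 / (c 0 + cfrac_conv n (\<lambda>k. c (Suc k)))"

(* [b_0 theta, b_1 theta, ...].  If b is 0 from some index on (a terminating expansion), the
   convention 1 / 0 = 0 makes this the corresponding finite continued fraction. *)
definition theta_cfrac :: "real \<Rightarrow> (nat \<Rightarrow> int) \<Rightarrow> real" where
  "theta_cfrac \<theta> b = lim (\<lambda>n. cfrac_conv n (\<lambda>k. real_of_int (b k) * \<theta>))"

definition ext_gauss_measure :: "real \<Rightarrow> (real \<times> real) measure" where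
  "ext_gauss_measure \<theta> =
     density (restrict_space lborel ({0..\<theta>} \<times> {0..\<theta>}))
       (\<lambda>(x, y). ennreal (1 / (ln (1 + \<theta>\<^sup>2) * (1 + x * y)\<^sup>2)))"

definition generated_sigma :: "'a set \<Rightarrow> ('i \<Rightarrow> 'a \<Rightarrow> 'b) \<Rightarrow> 'i set \<Rightarrow> 'b measure \<Rightarrow> 'a measure" where
  "generated_sigma \<Omega> X I N = sigma \<Omega> (\<Union>i\<in>I. {X i -` A \<inter> \<Omega> | A. A \<in> sets N})"

definition cond_prob_sigma :: "'a measure \<Rightarrow> 'a measure \<Rightarrow> 'a set \<Rightarrow> 'a \<Rightarrow> real" where
  "cond_prob_sigma M F B = real_cond_exp M F (indicator B)"

end

theory Submission
  imports Defs
begin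

text \<open>
  The digits with nonpositive index depend on the second coordinate only, and they determine it,
  since \<open>y\<close> is the limit of its convergents. Hence \<open>a\<close> is the second coordinate and the
  \<open>\<sigma>\<close>-algebra they generate consists of sets \<open>[0, \<theta>] \<times> A'\<close>. The conditional probability is
  then a quotient of two integrals of the density over horizontal slices, with
  \<open>\<integral>\<^sub>0\<^sup>t du / (1 + u y)\<^sup>2 = t / (1 + t y)\<close> taken at \<open>t = x\<close> and at \<open>t = \<theta>\<close>.
\<close>

section \<open>Expansions and the convergence of their convergents\<close>

lemma ext_digit_nonpos:
  "ext_digit \<theta> (- int k) p = digit1 \<theta> ((theta_map \<theta> ^^ k) (snd p))"
  \<comment> \<open>Index zero is the middle branch of \<open>ext_digit\<close>; for positive
    \<open>k\<close> the digit of index \<open>k + 1\<close> is read off after \<open>k\<close>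
    iterations.\<close>
  by (cases k) (auto simp: ext_digit_def digit_def nat_add_distrib)

text \<open>Away from zero the map is \<theta> times a fractional part.\<close>

lemma theta_map_bounds:
  assumes "0 < \<theta>"
  shows "theta_map \<theta> y \<in> {0..\<theta>}"
proof (cases "y = 0")
  case False
  then have "theta_map \<theta> y = \<theta> * frac (1 / (y * \<theta>))"
    using assms by (simp add: theta_map_def frac_def field_simps)
  moreover have "\<theta> * frac (1 / (y * \<theta>)) \<le> \<theta> * 1"
    using assms by (intro mult_left_mono) (auto intro: less_imp_le frac_lt_1)
  ultimately show ?thesis
    using assms by simp
qed (use assms in \<open>simp add: theta_map_def\<close>)

lemma theta_map_recurrence:
  assumes "y \<noteq> 0"
  shows "y = 1 / (real_of_int (digit1 \<theta> y) * \<theta> + theta_map \<theta> y)"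
  using assms by (simp add: digit1_def theta_map_def mult.commute)

text \<open>This is where \<theta> being the inverse root of an integer enters:
  \<open>1 / (y * \<theta>)\<close> is at least \<open>m\<close>, rounding down cannot fall below
  the integer \<open>m\<close>, and \<open>m * \<theta> = 1 / \<theta>\<close>.\<close>

lemma digit1_ge:
  assumes "0 < \<theta>" "m > 0" "\<theta>\<^sup>2 = 1 / real m" "0 < y" "y \<le> \<theta>"
  shows "1 / \<theta> \<le> real_of_int (digit1 \<theta> y) * \<theta>"
proof -
  have "y * \<theta> \<le> \<theta>\<^sup>2"
    using assms(1,5) by (simp add: power2_eq_square)
  then have "1 / \<theta>\<^sup>2 \<le> 1 / (y * \<theta>)"
    using assms(1,4) by (intro divide_left_mono) auto
  then have "real m \<le> 1 / (y * \<theta>)"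
    using assms(3) by simp
  then have "int m \<le> digit1 \<theta> y"
    unfolding digit1_def by (simp add: le_floor_iff)
  then have "real m \<le> real_of_int (digit1 \<theta> y)"
    by linarith
  then have "real m * \<theta> \<le> real_of_int (digit1 \<theta> y) * \<theta>"
    using assms(1) by simp
  moreover have "real m * \<theta> = 1 / \<theta>"
    using assms(1-3) by (simp add: power2_eq_square field_simps)
  ultimately show ?thesis by simp
qed

text \<open>One level of a continued fraction is a contraction: the difference of the reciprocals is
  their product times \<open>t - s\<close>, and each reciprocal is at most \<theta>.\<close>

lemma abs_inverse_add_diff_le:
  fixes r s t \<theta> :: real
  assumes "0 < \<theta>" "1 / \<theta> \<le> r" "0 \<le> s" "0 \<le> t"
  shows "\<bar>1 / (r + s) - 1 / (r + t)\<bar> \<le> \<theta>\<^sup>2 * \<bar>s - t\<bar>"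
proof -
  have "0 < 1 / \<theta>" using assms(1) by simp
  then have pos: "0 < r + s" "0 < r + t" using assms by linarith+
  have le: "1 / (r + s) \<le> \<theta>" "1 / (r + t) \<le> \<theta>"
    using assms pos by (auto simp: field_simps add_increasing2)
  have "1 / (r + s) - 1 / (r + t) = (1 / (r + s) * (1 / (r + t))) * (t - s)"
    using pos by (simp add: field_simps)
  then have "\<bar>1 / (r + s) - 1 / (r + t)\<bar> = (1 / (r + s) * (1 / (r + t))) * \<bar>s - t\<bar>"
    using pos by (simp add: abs_mult abs_minus_commute)
  also have "\<dots> \<le> (\<theta> * \<theta>) * \<bar>s - t\<bar>"
    using le pos assms(1) by (intro mult_right_mono mult_mono) auto
  finally show ?thesis by (simp add: power2_eq_square)
qed

text \<open>With \<open>1 / 0 = 0\<close> every level collapses to zero; this takes care of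
  expansions that have terminated.\<close>

lemma cfrac_conv_zero [simp]: "cfrac_conv n (\<lambda>_. 0) = 0"
  by (induction n) auto

lemma cfrac_conv_nonneg:
  assumes "\<And>k. 0 \<le> c k"
  shows "0 \<le> cfrac_conv n c"
  using assms by (induction n arbitrary: c) auto

lemma funpow_theta_map_zero [simp]: "(theta_map \<theta> ^^ k) 0 = 0"
  by (induction k) (auto simp: theta_map_def)

lemma funpow_theta_map_bounds:
  assumes "0 < \<theta>" "y \<in> {0..\<theta>}"
  shows "(theta_map \<theta> ^^ k) y \<in> {0..\<theta>}"
  using assms theta_map_bounds by (cases k) auto

text \<open>Induction with \<open>y\<close> varying: removing the first digit leaves a convergent of
  \<open>theta_map \<theta> y\<close>, and putting it back multiplies the error by at most
  \<open>\<theta>\<^sup>2\<close>. The convergent of length zero is 0, which is within \<theta> of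
  \<open>y\<close>.\<close>

lemma abs_cfrac_conv_digits_le:
  assumes "0 < \<theta>" "m > 0" "\<theta>\<^sup>2 = 1 / real m" "y \<in> {0..\<theta>}"
  shows "\<bar>cfrac_conv n (\<lambda>k. real_of_int (digit1 \<theta> ((theta_map \<theta> ^^ k) y)) * \<theta>) - y\<bar>
           \<le> (\<theta>\<^sup>2) ^ n * \<theta>"
  using assms(4)
proof (induction n arbitrary: y)
  case 0
  then show ?case by simp
next
  case (Suc n)
  show ?case
  proof (cases "y = 0")
    case True
    \<comment> \<open>Zero is a fixed point of the map and has digit 0, so all convergents
      vanish.\<close>
    then show ?thesis using assms(1) by (simp add: digit1_def)
  next
    case False
    define s where "s = cfrac_conv n
      (\<lambda>k. real_of_int (digit1 \<theta> ((theta_map \<theta> ^^ k) (theta_map \<theta> y))) * \<theta>)"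
    define r where "r = real_of_int (digit1 \<theta> y) * \<theta>"
    have digits_nonneg: "0 \<le> digit1 \<theta> z" if "z \<in> {0..\<theta>}" for z
      using that assms(1) by (simp add: digit1_def)
    have T: "theta_map \<theta> y \<in> {0..\<theta>}"
      by (rule theta_map_bounds[OF assms(1)])
    have "0 \<le> s"
      unfolding s_def using assms(1) digits_nonneg funpow_theta_map_bounds[OF assms(1) T]
      by (intro cfrac_conv_nonneg) simp
    moreover have "1 / \<theta> \<le> r"
      unfolding r_def using assms Suc.prems False by (intro digit1_ge) auto
    ultimately have "\<bar>1 / (r + s) - 1 / (r + theta_map \<theta> y)\<bar> \<le> \<theta>\<^sup>2 * \<bar>s - theta_map \<theta> y\<bar>"
      using assms(1) T by (intro abs_inverse_add_diff_le) auto
    also have "\<dots> \<le> \<theta>\<^sup>2 * ((\<theta>\<^sup>2) ^ n * \<theta>)"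
      using Suc.IH[OF T] unfolding s_def by (intro mult_left_mono) auto
    \<comment> \<open>By the recurrence, \<open>1 / (r + theta_map \<theta> y)\<close> is
      \<open>y\<close> itself.\<close>
    finally have "\<bar>1 / (r + s) - y\<bar> \<le> (\<theta>\<^sup>2) ^ Suc n * \<theta>"
      using theta_map_recurrence[OF False, of \<theta>] by (simp add: r_def mult.assoc)
    then show ?thesis
      by (simp add: r_def s_def funpow_swap1)
  qed
qed

text \<open>The error bound is geometric with ratio \<open>\<theta>\<^sup>2 < 1\<close>. Terminating
  expansions are included, so the identity holds at every point of the interval.\<close>

lemma theta_cfrac_digits:
  assumes "0 < \<theta>" "\<theta> < 1" "m > 0" "\<theta>\<^sup>2 = 1 / real m" "y \<in> {0..\<theta>}"
  shows "theta_cfrac \<theta> (\<lambda>k. digit1 \<theta> ((theta_map \<theta> ^^ k) y)) = y"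
proof -
  have "(\<lambda>n. (\<theta>\<^sup>2) ^ n * \<theta>) \<longlonglongrightarrow> 0 * \<theta>"
    using assms(1,2) by (intro tendsto_mult LIMSEQ_power_zero) (auto simp: power_less_one_iff)
  then have "(\<lambda>n. (\<theta>\<^sup>2) ^ n * \<theta>) \<longlonglongrightarrow> 0"
    by simp
  then have "(\<lambda>n. cfrac_conv n (\<lambda>k. real_of_int (digit1 \<theta> ((theta_map \<theta> ^^ k) y)) * \<theta>) - y)
               \<longlonglongrightarrow> 0"
    by (rule Lim_null_comparison[rotated], intro always_eventually allI)
      (simp only: real_norm_def abs_cfrac_conv_digits_le[OF assms(1,3-5)])
  then show ?thesis
    unfolding theta_cfrac_def by (intro limI) (simp add: LIM_zero_iff)
qed

section \<open>Measurability of digits and continued fractions\<close>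

lemma measurable_cfrac_conv:
  assumes "\<And>k. (\<lambda>p. c p k) \<in> borel_measurable M"
  shows "(\<lambda>p. cfrac_conv n (c p)) \<in> borel_measurable M"
  using assms
proof (induction n arbitrary: c)
  case (Suc n)
  have "(\<lambda>p. cfrac_conv n (\<lambda>k. c p (Suc k))) \<in> borel_measurable M"
    by (rule Suc.IH) (rule Suc.prems)
  with Suc.prems[of 0] show ?case by simp
qed simp

text \<open>The space \<open>M\<close> is arbitrary so that it can later be the \<sigma>-algebra
  generated by the digits. A pointwise \<open>lim\<close> of measurable real functions is measurable
  even where the sequence diverges.\<close>

lemma measurable_theta_cfrac:
  assumes "\<And>k. (\<lambda>p. b p k) \<in> M \<rightarrow>\<^sub>M count_space UNIV"
  shows "(\<lambda>p. theta_cfrac \<theta> (b p)) \<in> borel_measurable M"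
  unfolding theta_cfrac_def
proof (intro borel_measurable_lim_metric measurable_cfrac_conv)
  fix k
  show "(\<lambda>p. real_of_int (b p k) * \<theta>) \<in> borel_measurable M"
    using assms[of k] by measurable
qed

lemma measurable_theta_map [measurable]: "theta_map \<theta> \<in> borel_measurable borel"
  unfolding theta_map_def[abs_def] by measurable

lemma measurable_digit1 [measurable]: "digit1 \<theta> \<in> borel \<rightarrow>\<^sub>M count_space UNIV"
  unfolding digit1_def[abs_def] by measurable

lemma measurable_digit1_funpow:
  "(\<lambda>y. digit1 \<theta> ((theta_map \<theta> ^^ k) y)) \<in> borel \<rightarrow>\<^sub>M count_space UNIV"
proof -
  have "theta_map \<theta> ^^ k \<in> borel_measurable borel"
    by (induction k) (auto intro: measurable_comp[OF _ measurable_theta_map] simp: id_def)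
  then show ?thesis by measurable
qed

section \<open>The \<sigma>-algebra of the past\<close>

lemma sets_generated_sigma:
  "sets (generated_sigma \<Omega> X I N) = sigma_sets \<Omega> (\<Union>i\<in>I. {X i -` A \<inter> \<Omega> | A. A \<in> sets N})"
  unfolding generated_sigma_def by (intro sets_measure_of) auto

lemma space_generated_sigma [simp]: "space (generated_sigma \<Omega> X I N) = \<Omega>"
  unfolding generated_sigma_def by (intro space_measure_of) auto

lemma measurable_generated_sigma:
  assumes "i \<in> I" "X i \<in> \<Omega> \<rightarrow> space N"
  shows "X i \<in> generated_sigma \<Omega> X I N \<rightarrow>\<^sub>M N"
  using assms by (intro measurableI) (auto simp: sets_generated_sigma)

text \<open>Digits of nonpositive index ignore the first coordinate, so each generator is a strip
  over all of \<open>S\<close>. Strips with a Borel side are closed under complement and countable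
  union, so induction over the generated \<sigma>-algebra applies.\<close>

lemma generated_sigma_past_product:
  assumes "B \<in> sets (generated_sigma (S \<times> S') (ext_digit \<theta>) {..0} (count_space UNIV))"
    and "S' \<in> sets borel"
  obtains A where "A \<in> sets borel" "A \<subseteq> S'" "B = S \<times> A"
proof -
  have "B \<in> sigma_sets (S \<times> S')
      (\<Union>i\<in>{..0}. {ext_digit \<theta> i -` A \<inter> (S \<times> S') | A. A \<in> sets (count_space UNIV)})"
    using assms(1) by (simp add: sets_generated_sigma)
  then have "\<exists>A \<in> sets borel. A \<subseteq> S' \<and> B = S \<times> A"
  proof induction
    case (Basic B)
    then obtain i A where "i \<le> 0" and B: "B = ext_digit \<theta> i -` A \<inter> (S \<times> S')"
      by auto
    then obtain k where i: "i = - int k"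
      by (metis nonpos_int_cases)
    let ?A = "(\<lambda>y. digit1 \<theta> ((theta_map \<theta> ^^ k) y)) -` A \<inter> S'"
    have "?A \<in> sets borel"
      using measurable_sets[OF measurable_digit1_funpow[of \<theta> k], of A] assms(2) by auto
    moreover have "B = S \<times> ?A"
      unfolding B i by (auto simp: ext_digit_nonpos)
    ultimately show ?case
      by (intro bexI[of _ ?A]) auto
  next
    case Empty
    show ?case by (rule bexI[of _ "{}"]) auto
  next
    case (Compl B)
    then obtain A where A: "A \<in> sets borel" "A \<subseteq> S'" "B = S \<times> A" by blast
    then show ?case
      \<comment> \<open>Inside \<open>S \<times> S'\<close> only the second side of the strip gets
        complemented.\<close>
      using assms(2) by (intro bexI[of _ "S' - A"]) auto
  next
    case (Union B)
    then have "\<forall>i. \<exists>A. A \<in> sets borel \<and> A \<subseteq> S' \<and> B i = S \<times> A" by blast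
    then obtain A where "\<And>i. A i \<in> sets borel \<and> A i \<subseteq> S' \<and> B i = S \<times> A i" by metis
    then show ?case by (intro bexI[of _ "\<Union>i. A i"]) auto
  qed
  then show thesis using that by blast
qed

section \<open>The extended Gauss measure and its horizontal slices\<close>

lemma sets_ext_gauss_measure:
  "sets (ext_gauss_measure \<theta>) = sets (restrict_space borel ({0..\<theta>} \<times> {0..\<theta>}))"
  by (simp add: ext_gauss_measure_def sets_restrict_space)

lemma space_ext_gauss_measure [simp]: "space (ext_gauss_measure \<theta>) = {0..\<theta>} \<times> {0..\<theta>}"
  by (simp add: ext_gauss_measure_def space_restrict_space)

lemma borel_measurable_ext_gauss_measure:
  fixes f :: "real \<times> real \<Rightarrow> 'b::topological_space"
  assumes "f \<in> borel_measurable borel"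
  shows "f \<in> borel_measurable (ext_gauss_measure \<theta>)"
  using measurable_restrict_space1[OF assms]
  by (simp add: measurable_cong_sets[OF sets_ext_gauss_measure refl])

text \<open>Tonelli with the second coordinate outermost: conditioning on the past fixes
  \<open>y\<close>, so the inner integral runs over a horizontal slice.\<close>

lemma nn_integral_ext_gauss_measure:
  assumes [measurable]: "f \<in> borel_measurable borel"
  shows "(\<integral>\<^sup>+ p. f p \<partial>ext_gauss_measure \<theta>) =
    (\<integral>\<^sup>+ y. (\<integral>\<^sup>+ u. ennreal (1 / (ln (1 + \<theta>\<^sup>2) * (1 + u * y)\<^sup>2)) * f (u, y) * indicator {0..\<theta>} u
        \<partial>lborel) * indicator {0..\<theta>} y \<partial>lborel)"
proof -
  let ?S = "{0..\<theta>} \<times> {0..\<theta>}"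
  let ?d = "\<lambda>(x, y). ennreal (1 / (ln (1 + \<theta>\<^sup>2) * (1 + x * y)\<^sup>2))"
  have S [measurable]: "?S \<in> sets (borel :: (real \<times> real) measure)"
    by (intro borel_closed closed_Times) auto
  \<comment> \<open>Measurability is recorded in two forms: for the Borel sets of the plane, where
    the measure lives, and for the product \<sigma>-algebra, where Tonelli is applied.\<close>
  have d [measurable]: "?d \<in> borel_measurable (borel \<Otimes>\<^sub>M borel)"
    by measurable
  have d' [measurable]: "?d \<in> borel_measurable borel"
    using d by (simp only: borel_prod)
  have f' [measurable]: "f \<in> borel_measurable (borel \<Otimes>\<^sub>M borel)"
    using assms by (simp only: borel_prod)
  have "(\<integral>\<^sup>+ p. f p \<partial>ext_gauss_measure \<theta>) = (\<integral>\<^sup>+ p. ?d p * f p \<partial>restrict_space lborel ?S)"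
    unfolding ext_gauss_measure_def
    by (intro nn_integral_density measurable_restrict_space1) simp_all
  also have "\<dots> = (\<integral>\<^sup>+ p. ?d p * f p * indicator ?S p \<partial>lborel)"
    by (intro nn_integral_restrict_space) simp
  also have "\<dots> = (\<integral>\<^sup>+ p. ?d p * f p * indicator ?S p \<partial>(lborel \<Otimes>\<^sub>M lborel))"
    by (simp only: lborel_prod)
  also have "\<dots> = (\<integral>\<^sup>+ y. (\<integral>\<^sup>+ u. ?d (u, y) * f (u, y) * indicator ?S (u, y) \<partial>lborel) \<partial>lborel)"
    by (intro lborel_pair.nn_integral_snd[symmetric]) measurable
  also have "\<dots> = (\<integral>\<^sup>+ y. (\<integral>\<^sup>+ u. ?d (u, y) * f (u, y) * indicator {0..\<theta>} u \<partial>lborel)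
      * indicator {0..\<theta>} y \<partial>lborel)"
    by (intro nn_integral_cong) (auto simp: indicator_def)
  finally show ?thesis by simp
qed

text \<open>The antiderivative \<open>u / (c * (1 + u * y))\<close> vanishes at 0 and, unlike
  \<open>- 1 / (c * y * (1 + u * y))\<close>, also covers \<open>y = 0\<close>. The constant
  \<open>c\<close> stands for the normalisation \<open>ln (1 + \<theta>\<^sup>2)\<close>.\<close>

lemma nn_integral_slice:
  fixes c t y :: real
  assumes "0 < c" "0 \<le> t" "0 \<le> y"
  shows "(\<integral>\<^sup>+ u. ennreal (1 / (c * (1 + u * y)\<^sup>2)) * indicator {0..t} u \<partial>lborel)
           = ennreal (t / (c * (1 + t * y)))"
proof -
  have pos: "0 < 1 + u * y" if "0 \<le> u" for u
    using that assms(3) by (simp add: add_pos_nonneg)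
  have "(\<integral>\<^sup>+ u. ennreal (1 / (c * (1 + u * y)\<^sup>2)) * indicator {0..t} u \<partial>lborel)
      = ennreal (t / (c * (1 + t * y)) - 0 / (c * (1 + 0 * y)))"
  proof (rule nn_integral_FTC_Icc)
    fix u assume "u \<in> {0..t}"
    then have p: "0 < 1 + u * y" using pos by simp
    then have "((\<lambda>u. u / (c * (1 + u * y))) has_real_derivative
        (1 * (c * (1 + u * y)) - u * (c * y)) / (c * (1 + u * y) * (c * (1 + u * y)))) (at u)"
      using assms(1) by (auto intro!: derivative_eq_intros)
    moreover have "(1 * (c * (1 + u * y)) - u * (c * y)) / (c * (1 + u * y) * (c * (1 + u * y)))
        = c / (c * (1 + u * y) * (c * (1 + u * y)))"
      by (simp add: algebra_simps)
    moreover have "c / (c * (1 + u * y) * (c * (1 + u * y))) = 1 / (c * (1 + u * y)\<^sup>2)"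
      using assms(1) by (simp add: power2_eq_square)
    ultimately show "((\<lambda>u. u / (c * (1 + u * y))) has_real_derivative
        1 / (c * (1 + u * y)\<^sup>2)) (at u)"
      by simp
  qed (use assms in auto)
  then show ?thesis by simp
qed

text \<open>Finiteness makes conditional expectations available and bounded functions integrable.
  Each slice has mass at most \<open>\<theta> / c\<close>, since \<open>1 + \<theta> * y\<close> is
  at least 1.\<close>

lemma finite_measure_ext_gauss_measure:
  assumes "0 < \<theta>"
  shows "finite_measure (ext_gauss_measure \<theta>)"
proof
  define c where "c = ln (1 + \<theta>\<^sup>2)"
  have c: "0 < c" unfolding c_def using assms by (simp add: ln_gt_zero)
  have "emeasure (ext_gauss_measure \<theta>) (space (ext_gauss_measure \<theta>))
      = (\<integral>\<^sup>+ p. 1 \<partial>ext_gauss_measure \<theta>)"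
    by simp
  also have "\<dots> = (\<integral>\<^sup>+ y. ennreal (\<theta> / (c * (1 + \<theta> * y))) * indicator {0..\<theta>} y \<partial>lborel)"
    unfolding nn_integral_ext_gauss_measure[of "\<lambda>_. 1", OF borel_measurable_const]
      c_def[symmetric] mult_1_right
    using assms c by (intro nn_integral_cong) (simp add: nn_integral_slice split: split_indicator)
  also have "\<dots> \<le> (\<integral>\<^sup>+ y. ennreal (\<theta> / c) * indicator {0..\<theta>} y \<partial>lborel)"
    using assms c by (intro nn_integral_mono)
      (auto simp: indicator_def intro!: ennreal_leI divide_left_mono mult_pos_pos add_pos_nonneg)
  also have "\<dots> < \<infinity>"
    using assms by (simp add: nn_integral_cmult_indicator ennreal_mult_less_top)
  finally show "emeasure (ext_gauss_measure \<theta>) (space (ext_gauss_measure \<theta>)) \<noteq> \<infinity>"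
    by simp
qed

section \<open>Conditioning on the past\<close>

lemma subalgebra_past:
  "subalgebra (ext_gauss_measure \<theta>)
     (generated_sigma ({0..\<theta>} \<times> {0..\<theta>}) (ext_digit \<theta>) {..0} (count_space UNIV))"
  unfolding subalgebra_def
proof (intro conjI subsetI)
  fix B
  assume "B \<in> sets (generated_sigma ({0..\<theta>} \<times> {0..\<theta>}) (ext_digit \<theta>) {..0} (count_space UNIV))"
  then obtain A where A: "A \<in> sets borel" "A \<subseteq> {0..\<theta>}" "B = {0..\<theta>} \<times> A"
    by (rule generated_sigma_past_product) simp
  then have "B \<in> sets (borel \<Otimes>\<^sub>M borel)"
    by auto
  then have "B \<in> sets borel"
    by (simp only: borel_prod)
  moreover have "B = ({0..\<theta>} \<times> {0..\<theta>}) \<inter> B"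
    using A by auto
  ultimately show "B \<in> sets (ext_gauss_measure \<theta>)"
    unfolding sets_ext_gauss_measure sets_restrict_space by blast
qed simp

text \<open>The defining identity of the conditional probability, tested on a strip. It holds slice
  by slice: for \<open>y\<close> in \<open>A\<close> both inner integrals equal
  \<open>x / (c * (1 + x * y))\<close>.\<close>

lemma nn_integral_strip:
  fixes \<theta> x :: real
  assumes "0 < \<theta>" "x \<in> {0..\<theta>}" "A \<in> sets borel"
  shows "(\<integral>\<^sup>+ p. indicator ({0..\<theta>} \<times> A) p * indicator ({0..x} \<times> {0..\<theta>}) p \<partial>ext_gauss_measure \<theta>)
    = (\<integral>\<^sup>+ p. indicator ({0..\<theta>} \<times> A) p
         * ennreal ((snd p * \<theta> + 1) * x / ((snd p * x + 1) * \<theta>)) \<partial>ext_gauss_measure \<theta>)"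
    (is "(\<integral>\<^sup>+ p. ?f p \<partial>_) = (\<integral>\<^sup>+ p. ?g p \<partial>_)")
proof -
  define c where "c = ln (1 + \<theta>\<^sup>2)"
  have c: "0 < c" unfolding c_def using assms(1) by (simp add: ln_gt_zero)
  note assms(3) [measurable]
  have "?f \<in> borel_measurable (borel \<Otimes>\<^sub>M borel)" "?g \<in> borel_measurable (borel \<Otimes>\<^sub>M borel)"
    by measurable
  then have meas: "?f \<in> borel_measurable borel" "?g \<in> borel_measurable borel"
    by (simp_all only: borel_prod)
  have inner_f: "(\<integral>\<^sup>+ u. ennreal (1 / (c * (1 + u * y)\<^sup>2)) * ?f (u, y) * indicator {0..\<theta>} u \<partial>lborel)
      = indicator A y * ennreal (x / (c * (1 + x * y)))" if y: "y \<in> {0..\<theta>}" for y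
  proof -
    have "(\<integral>\<^sup>+ u. ennreal (1 / (c * (1 + u * y)\<^sup>2)) * ?f (u, y) * indicator {0..\<theta>} u \<partial>lborel)
      = (\<integral>\<^sup>+ u. indicator A y * (ennreal (1 / (c * (1 + u * y)\<^sup>2)) * indicator {0..x} u) \<partial>lborel)"
      \<comment> \<open>As \<open>x \<le> \<theta>\<close>, the slice of the event cuts the range of
        \<open>u\<close> down to \<open>{0..x}\<close>.\<close>
      using assms(2) y by (intro nn_integral_cong) (auto simp: indicator_def)
    also have "\<dots> = indicator A y * ennreal (x / (c * (1 + x * y)))"
      using assms c y by (subst nn_integral_cmult) (auto simp: nn_integral_slice)
    finally show ?thesis .
  qed
  have inner_g: "(\<integral>\<^sup>+ u. ennreal (1 / (c * (1 + u * y)\<^sup>2)) * ?g (u, y) * indicator {0..\<theta>} u \<partial>lborel)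
      = indicator A y * ennreal (x / (c * (1 + x * y)))" if y: "y \<in> {0..\<theta>}" for y
  proof -
    \<comment> \<open>The slice mass up to \<open>x\<close> divided by the slice mass up to
      \<theta>. It does not depend on \<open>u\<close>, so it leaves the inner integral and cancels
      the full slice mass.\<close>
    let ?k = "(y * \<theta> + 1) * x / ((y * x + 1) * \<theta>)"
    have pos: "0 < 1 + \<theta> * y" "0 < 1 + x * y"
      using assms y by (auto simp: add_pos_nonneg)
    have k: "0 \<le> ?k" using assms y by auto
    have "(\<integral>\<^sup>+ u. ennreal (1 / (c * (1 + u * y)\<^sup>2)) * ?g (u, y) * indicator {0..\<theta>} u \<partial>lborel)
      = (\<integral>\<^sup>+ u. indicator A y * ennreal ?k *
          (ennreal (1 / (c * (1 + u * y)\<^sup>2)) * indicator {0..\<theta>} u) \<partial>lborel)"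
      by (intro nn_integral_cong) (auto simp: indicator_def mult.commute)
    also have "\<dots> = indicator A y * ennreal ?k * ennreal (\<theta> / (c * (1 + \<theta> * y)))"
      using assms c y by (subst nn_integral_cmult) (auto simp: nn_integral_slice)
    also have "\<dots> = indicator A y * ennreal (?k * (\<theta> / (c * (1 + \<theta> * y))))"
      using k by (simp only: ennreal_mult' mult.assoc)
    also have "?k * (\<theta> / (c * (1 + \<theta> * y))) = x / (c * (1 + x * y))"
    proof -
      have "?k * (\<theta> / (c * (1 + \<theta> * y)))
          = ((1 + \<theta> * y) * x * \<theta>) / ((1 + x * y) * \<theta> * (c * (1 + \<theta> * y)))"
        by (simp add: ac_simps)
      also have "\<dots> = x / (c * (1 + x * y))"
        using pos c assms(1) by (simp add: divide_simps)
      finally show ?thesis .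
    qed
    finally show ?thesis .
  qed
  show ?thesis
    unfolding nn_integral_ext_gauss_measure[OF meas(1)] nn_integral_ext_gauss_measure[OF meas(2)]
      c_def[symmetric]
    using inner_f inner_g by (intro nn_integral_cong) (auto simp: indicator_def)
qed

theorem theorem3p4:
  fixes \<theta> :: real and m :: nat and x :: real
  assumes "0 < \<theta>" and "\<theta> < 1" and "m > 0" and "\<theta>\<^sup>2 = 1 / real m"
    and "x \<in> {0..\<theta>}"
  shows "AE p in ext_gauss_measure \<theta>.
    (let a = theta_cfrac \<theta> (\<lambda>k. ext_digit \<theta> (- int k) p) in
     cond_prob_sigma (ext_gauss_measure \<theta>)
       (generated_sigma ({0..\<theta>} \<times> {0..\<theta>}) (ext_digit \<theta>) {..0} (count_space UNIV))
       ({0..x} \<times> {0..\<theta>}) p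
     = (a * \<theta> + 1) * x / ((a * x + 1) * \<theta>))"
proof -
  let ?M = "ext_gauss_measure \<theta>"
  let ?F = "generated_sigma ({0..\<theta>} \<times> {0..\<theta>}) (ext_digit \<theta>) {..0} (count_space UNIV)"
  let ?B = "{0..x} \<times> {0..\<theta>}"
  let ?a = "\<lambda>p. theta_cfrac \<theta> (\<lambda>k. ext_digit \<theta> (- int k) p)"
  let ?h = "\<lambda>a. (a * \<theta> + 1) * x / ((a * x + 1) * \<theta>)"
  let ?g = "\<lambda>p. ?h (snd p)"
  interpret finite_measure ?M
    by (rule finite_measure_ext_gauss_measure[OF assms(1)])
  interpret finite_measure_subalgebra ?M ?F
    by unfold_locales (rule subalgebra_past)
  have a: "?a p = snd p" if "p \<in> {0..\<theta>} \<times> {0..\<theta>}" for p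
    using that theta_cfrac_digits[OF assms(1-4), of "snd p"] by (auto simp: ext_digit_nonpos)
  \<comment> \<open>Measurability with respect to the past is proved for the continued fraction, a
    limit of functions of the generating digits, and then carried over to \<open>snd p\<close>,
    which agrees with it on the whole square.\<close>
  have "(\<lambda>p. ?h (?a p)) \<in> borel_measurable ?F"
    by (intro borel_measurable_divide borel_measurable_times borel_measurable_add
        borel_measurable_const measurable_theta_cfrac measurable_generated_sigma) auto
  then have g_F: "?g \<in> borel_measurable ?F"
    by (rule measurable_cong[THEN iffD1, rotated]) (use a in auto)
  have "?B \<in> sets (borel \<Otimes>\<^sub>M borel)"
    by measurable
  then have B_borel: "?B \<in> sets borel"
    by (simp only: borel_prod)
  have f_M: "(indicator ?B :: real \<times> real \<Rightarrow> real) \<in> borel_measurable ?M"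
    using B_borel by (intro borel_measurable_ext_gauss_measure) simp
  have g_M: "?g \<in> borel_measurable ?M"
    by (rule measurable_from_subalg[OF subalgebra_past g_F])
  have g_nonneg: "0 \<le> ?h y" if "y \<in> {0..\<theta>}" for y
    using that assms by auto
  \<comment> \<open>The numerator is largest at \<open>y = \<theta>\<close> and the denominator is
    at least \<theta>; this bound gives integrability.\<close>
  have g_le: "?h y \<le> (\<theta> * \<theta> + 1) * x / \<theta>" if y: "y \<in> {0..\<theta>}" for y
  proof (rule frac_le)
    show "(y * \<theta> + 1) * x \<le> (\<theta> * \<theta> + 1) * x"
      using y assms by (intro mult_right_mono add_right_mono) auto
    show "\<theta> \<le> (y * x + 1) * \<theta>"
      using y assms by (simp add: algebra_simps)
  qed (use assms in auto)
  have f_int: "integrable ?M (indicator ?B :: real \<times> real \<Rightarrow> real)"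
    using f_M by (intro integrable_const_bound[where B = 1]) auto
  have g_int: "integrable ?M ?g"
  proof (rule integrable_const_bound)
    show "AE p in ?M. norm (?g p) \<le> (\<theta> * \<theta> + 1) * x / \<theta>"
    proof (rule AE_I2)
      fix p assume "p \<in> space ?M"
      then have "snd p \<in> {0..\<theta>}" by (simp add: mem_Times_iff)
      then show "norm (?g p) \<le> (\<theta> * \<theta> + 1) * x / \<theta>"
        using g_le g_nonneg by (simp only: real_norm_def abs_of_nonneg)
    qed
  qed (rule g_M)
  have "AE p in ?M. real_cond_exp ?M ?F (indicator ?B) p = ?g p"
  \<comment> \<open>It suffices that \<open>?g\<close> is integrable, measurable for the past, and
    has the same integral as the indicator over every set of the past.\<close>
  proof (rule real_cond_exp_charact)
    fix C assume C: "C \<in> sets ?F"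
    then have C_M: "C \<in> sets ?M"
      using subalgebra_past by (auto simp: subalgebra_def)
    obtain A where A: "A \<in> sets borel" "A \<subseteq> {0..\<theta>}" "C = {0..\<theta>} \<times> A"
      using generated_sigma_past_product[OF C] by auto
    \<comment> \<open>Both integrands are nonnegative, so the identity is moved to nonnegative
      integrals, where the strip lemma applies, and back.\<close>
    have "(\<integral>p\<in>C. indicator ?B p \<partial>?M) = enn2real (\<integral>\<^sup>+ p. ennreal (indicator C p * indicator ?B p) \<partial>?M)"
      unfolding set_lebesgue_integral_def using f_M C_M
      by (subst integral_eq_nn_integral) auto
    also have "\<dots> = enn2real (\<integral>\<^sup>+ p. indicator C p * indicator ?B p \<partial>?M)"
      by (intro arg_cong[where f = enn2real] nn_integral_cong) (auto simp: indicator_def)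
    also have "\<dots> = enn2real (\<integral>\<^sup>+ p. indicator C p * ennreal (?g p) \<partial>?M)"
      using nn_integral_strip[OF assms(1,5) A(1)] unfolding A(3) by simp
    also have "\<dots> = enn2real (\<integral>\<^sup>+ p. ennreal (indicator C p * ?g p) \<partial>?M)"
      by (intro arg_cong[where f = enn2real] nn_integral_cong) (auto simp: indicator_def)
    also have "\<dots> = (\<integral>p\<in>C. ?g p \<partial>?M)"
      unfolding set_lebesgue_integral_def real_scaleR_def
    proof (rule integral_eq_nn_integral[symmetric])
      show "(\<lambda>p. indicator C p * ?g p) \<in> borel_measurable ?M"
        using C_M by (intro borel_measurable_times g_M) simp
      show "AE p in ?M. 0 \<le> indicator C p * ?g p"
        by (intro AE_I2 mult_nonneg_nonneg g_nonneg) (auto simp: mem_Times_iff)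
    qed
    finally show "(\<integral>p\<in>C. indicator ?B p \<partial>?M) = (\<integral>p\<in>C. ?g p \<partial>?M)" .
  qed (use f_int g_int g_F in auto)
  then show ?thesis
    unfolding cond_prob_sigma_def Let_def
    \<comment> \<open>On the space \<open>snd p\<close> is replaced by the continued fraction at
      every point.\<close>
    by (rule AE_mp) (use a in \<open>auto intro!: AE_I2\<close>)
qed

end
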